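(* Let $\Xi=\{0,1\}$. Let $\Delta_{out}\in\{0,\dots,\Delta\}$ and $\Delta_r:=\Delta-\Delta_{out}$. Let $G,H$ be disjoint subgraphs of the grid such that $|H|=\Delta_{out}$ and $G$ is a connected component with the same value $x_{i,j}$ for every $(i,j)\in G$ and $\tilde\rho:=|G|-\Delta+\Delta_{out}>0$. Let $w^\beta,w^\gamma$ be the path weights on the edges of $G$ constructed as described in the context. Every feasible point $(d,\delta,\beta,\gamma)$ of (IP) fulfills the inequality $$\tilde\rho\sum_{(i,j)\in G}\delta_{i,j}-\bar M\Delta_{out}\ \le\ \sum_{((i,j),(i+1,j))\in G\times G}w^\beta_{i,j}\beta_{i,j}+\sum_{((i,j),(i,j+1))\in G\times G}w^\gamma_{i,j}\gamma_{i,j}-\bar M\sum_{(i,j)\in H}\delta_{i,j}$$ for all $\bar M\ge M_0$, where $$M_0:=\tilde\rho-\min_{U\subset G,\ \Delta\ge|U|>\Delta_r}\frac{(|G|-|U|)|U|-(|G|-\Delta_r)\Delta_r}{|U|-\Delta_r}=\tilde\rho-\frac{(|G|-\min\{|G|,\Delta\})\min\{|G|,\Delta\}-(|G|-\Delta_r)\Delta_r}{\min\{|G|,\Delta\}-\Delta_r}.$$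
   Context: Setting: $N,M\in\mathbb{N}$, $[N]:=\{1,\dots,N\}$, $x\in\Xi^{N\times M}$, $c\in\mathbb{R}^{N\times M}$, $\alpha>0$, $\Delta\in\mathbb{N}$. (IP): minimize $\sum_{i=1}^N\sum_{j=1}^M c_{i,j}d_{i,j}+\alpha\bigl(\sum_{j=1}^M\sum_{i=1}^{N-1}\beta_{i,j}+\sum_{i=1}^N\sum_{j=1}^{M-1}\gamma_{i,j}\bigr)$ over $d\in\mathbb{Z}^{N\times M}$, $\delta\in\mathbb{R}^{N\times M}$, $\beta\in\mathbb{R}^{(N-1)\times M}$, $\gamma\in\mathbb{R}^{N\times(M-1)}$ subject to - $\min\Xi\le x_{i,j}+d_{i,j}\le\max\Xi$ for $i\in[N],j\in[M]$; - $-\beta_{i,j}\le x_{i+1,j}+d_{i+1,j}-x_{i,j}-d_{i,j}\le\beta_{i,j}$ for $i\in[N-1],j\in[M]$; - $-\gamma_{i,j}\le x_{i,j+1}+d_{i,j+1}-x_{i,j}-d_{i,j}\le\gamma_{i,j}$ for $i\in[N],j\in[M-1]$; - $-\delta_{i,j}\le d_{i,j}\le\delta_{i,j}$ for $i\in[N],j\in[M]$; - $\sum_{i=1}^N\sum_{j=1}^M\delta_{i,j}\le\Delta$. The grid is the graph with node set $[N]\times[M]$ in which two nodes are joined by an edge if they differ by exactly one in exactly one coordinate and agree in the other. Subgraphs are identified with their node sets (with all grid edges between their nodes), and $|\cdot|$ is the number of nodes. That $G$ is a connected component means here that it is a connected subgraph of the grid. The sums over $((i,j),(i+1,j))\in G\times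 G$ and $((i,j),(i,j+1))\in G\times G$ run over all such pairs with both nodes in $G$. Path weights: every edge of the subgraph $G$ starts with weight $1$. For every edge $(v,w)$ that has to be added to turn $G$ into the fully connected graph on its node set (one for every unordered pair of distinct nodes of $G$ not joined by an edge of $G$), choose a path from $v$ to $w$ at random among the shortest paths between these nodes in $G$ and increase the weight of every edge on this path by $1$. The resulting weight of the edge between $(i,j)$ and $(i+1,j)$ is $w^\beta_{i,j}$, and that of the edge between $(i,j)$ and $(i,j+1)$ is $w^\gamma_{i,j}$.
   Formalization: The inequality is proved for feasible points with δ_{i,j}=|d_{i,j}| on G∪H, since with slack δ>|d| (e.g. d=β=γ=0, δ≠0 on G) it fails; for Δ_out=0, where the minimum is over an empty family, it is proved for every real M̄ and the M_0 formula is not claimed. *)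

theory Defs
  imports Complex_Main
begin

type_synonym node = "nat \<times> nat"

definition grid_nodes :: "nat \<Rightarrow> nat \<Rightarrow> node set" where
  "grid_nodes N M = {1..N} \<times> {1..M}"

definition grid_adj :: "node \<Rightarrow> node \<Rightarrow> bool" where
  "grid_adj v w \<longleftrightarrow>
     (snd v = snd w \<and> (fst w = Suc (fst v) \<or> fst v = Suc (fst w))) \<or>
     (fst v = fst w \<and> (snd w = Suc (snd v) \<or> snd v = Suc (snd w)))"

text \<open>A subgraph is identified with its node set \<open>G\<close>; its edges are all grid edges between
  nodes of \<open>G\<close>, written as two-element sets.\<close>

definition path_in :: "node set \<Rightarrow> node \<Rightarrow> node \<Rightarrow> node list \<Rightarrow> bool" where
  "path_in G v w p \<longleftrightarrow>
     p \<noteq> [] \<and> hd p = v \<and> last p = w \<and> set p \<subseteq> G \<and> distinct p \<and> successively grid_adj p"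

definition connected_subgraph :: "node set \<Rightarrow> bool" where
  "connected_subgraph G \<longleftrightarrow> G \<noteq> {} \<and> (\<forall>v\<in>G. \<forall>w\<in>G. \<exists>p. path_in G v w p)"

definition shortest_path_in :: "node set \<Rightarrow> node \<Rightarrow> node \<Rightarrow> node list \<Rightarrow> bool" where
  "shortest_path_in G v w p \<longleftrightarrow>
     path_in G v w p \<and> (\<forall>q. path_in G v w q \<longrightarrow> length p \<le> length q)"

definition path_edges :: "node list \<Rightarrow> node set set" where
  "path_edges p = {{p ! k, p ! Suc k} | k. Suc k < length p}"

definition missing_edges :: "node set \<Rightarrow> node set set" where
  "missing_edges G = {{v, w} | v w. v \<in> G \<and> w \<in> G \<and> v \<noteq> w \<and> \<not> grid_adj v w}"

text \<open>One possible outcome of the random choice of a shortest path for every missing edge.\<close>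

definition shortest_path_choice :: "node set \<Rightarrow> (node set \<Rightarrow> node list) \<Rightarrow> bool" where
  "shortest_path_choice G P \<longleftrightarrow>
     (\<forall>e\<in>missing_edges G. \<exists>v w. e = {v, w} \<and> shortest_path_in G v w (P e))"

definition path_weight :: "node set \<Rightarrow> (node set \<Rightarrow> node list) \<Rightarrow> node set \<Rightarrow> nat" where
  "path_weight G P e = 1 + card {f \<in> missing_edges G. e \<in> path_edges (P f)}"

definition w_beta :: "node set \<Rightarrow> (node set \<Rightarrow> node list) \<Rightarrow> nat \<Rightarrow> nat \<Rightarrow> nat" where
  "w_beta G P i j = path_weight G P {(i, j), (i + 1, j)}"

definition w_gamma :: "node set \<Rightarrow> (node set \<Rightarrow> node list) \<Rightarrow> nat \<Rightarrow> nat \<Rightarrow> nat" where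
  "w_gamma G P i j = path_weight G P {(i, j), (i, j + 1)}"

text \<open>Matrices are functions of two indices, of which only the entries in the stated (1-based)
  ranges matter.  The constraints bound \<open>\<delta>\<close> only from below by \<open>\<bar>d\<bar>\<close>, so a feasible point may
  have \<open>\<delta> i j > \<bar>d i j\<bar>\<close>.  With such slack the cut inequality fails (\<open>d = 0\<close>, \<open>\<beta> = \<gamma> = 0\<close>, \<open>\<delta> \<noteq> 0\<close>),
  hence the theorem assumes \<open>\<delta> = \<bar>d\<bar>\<close> separately on the entries that the inequality mentions.\<close>

definition ip_feasible ::
  "int set \<Rightarrow> nat \<Rightarrow> nat \<Rightarrow> (nat \<Rightarrow> nat \<Rightarrow> int) \<Rightarrow> nat \<Rightarrow>
   (nat \<Rightarrow> nat \<Rightarrow> int) \<Rightarrow> (nat \<Rightarrow> nat \<Rightarrow> real) \<Rightarrow> (nat \<Rightarrow> nat \<Rightarrow> real) \<Rightarrow> (nat \<Rightarrow> nat \<Rightarrow> real) \<Rightarrow> bool" where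
  "ip_feasible \<Xi> N M x \<Delta> d \<delta> \<beta> \<gamma> \<longleftrightarrow>
     (\<forall>i\<in>{1..N}. \<forall>j\<in>{1..M}. Min \<Xi> \<le> x i j + d i j \<and> x i j + d i j \<le> Max \<Xi>) \<and>
     (\<forall>i\<in>{1..<N}. \<forall>j\<in>{1..M}.
        - \<beta> i j \<le> of_int (x (i + 1) j + d (i + 1) j - x i j - d i j) \<and>
        of_int (x (i + 1) j + d (i + 1) j - x i j - d i j) \<le> \<beta> i j) \<and>
     (\<forall>i\<in>{1..N}. \<forall>j\<in>{1..<M}.
        - \<gamma> i j \<le> of_int (x i (j + 1) + d i (j + 1) - x i j - d i j) \<and>
        of_int (x i (j + 1) + d i (j + 1) - x i j - d i j) \<le> \<gamma> i j) \<and>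
     (\<forall>i\<in>{1..N}. \<forall>j\<in>{1..M}. - \<delta> i j \<le> of_int (d i j) \<and> of_int (d i j) \<le> \<delta> i j) \<and>
     (\<Sum>i=1..N. \<Sum>j=1..M. \<delta> i j) \<le> real \<Delta>"

definition rho :: "node set \<Rightarrow> nat \<Rightarrow> nat \<Rightarrow> real" where
  "rho G \<Delta> \<Delta>out = real (card G) - real \<Delta> + real \<Delta>out"

text \<open>Here \<open>\<Delta>r\<close> is \<open>\<Delta> - \<Delta>out\<close>.  For \<open>\<Delta>out = 0\<close> the minimum ranges over the empty family and
  \<open>M0\<close> is meaningless: mathematically it is then \<open>-\<infinity>\<close>, so no lower bound is imposed.\<close>

definition M0 :: "node set \<Rightarrow> nat \<Rightarrow> nat \<Rightarrow> real" where
  "M0 G \<Delta> \<Delta>out =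
     (let \<Delta>r = real \<Delta> - real \<Delta>out; g = real (card G) in
      rho G \<Delta> \<Delta>out -
      Min {((g - real (card U)) * real (card U) - (g - \<Delta>r) * \<Delta>r) / (real (card U) - \<Delta>r) | U.
             U \<subseteq> G \<and> card U \<le> \<Delta> \<and> real (card U) > \<Delta>r})"

end

theory Submission
  imports Defs
begin

text \<open>Since \<open>x\<close> is constant on \<open>G\<close> and all values stay in \<open>{0, 1}\<close>, a feasible point is described
  on \<open>G\<close> by the set \<open>U\<close> of changed nodes: every edge of \<open>G\<close> leaving \<open>U\<close> costs at least \<open>1\<close> in
  \<open>\<beta>\<close> or \<open>\<gamma>\<close>. The path weights are made so that this cut is expensive. Every one of the
  \<open>|U| (|G| - |U|)\<close> pairs separated by \<open>U\<close> is either an edge, paid by the initial weight \<open>1\<close>, or a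
  missing edge whose path has to cross the cut, paid by the increment along that path. So the
  weighted sum of \<open>\<beta>\<close> and \<open>\<gamma>\<close> is at least \<open>|U| (|G| - |U|)\<close> (lemma
  \<open>weighted_variation_ge\<close>).

  What remains is arithmetic (lemma \<open>cut_inequality_arith\<close>). The quotient in the
  definition of \<open>M0\<close> cancels, by
  \<open>(g - u) u - (g - r) r = (u - r) (g - u - r)\<close>, to \<open>g - u - r\<close>. It is decreasing in
  \<open>u\<close>, hence minimal for the largest admissible set, so for \<open>\<Delta>out > 0\<close> the threshold
  \<open>M0 = min g \<Delta>\<close> is simply the largest
  number of nodes of \<open>G\<close> that the budget allows to change. If \<open>u = |U| \<le> \<Delta>r\<close>, the cut alone
  pays for \<open>(g - \<Delta>r) u\<close>, because \<open>g - \<Delta>r \<le> g - u\<close>. If \<open>u > \<Delta>r\<close>, this quantity exceeds the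
  bound \<open>(g - u) u\<close> by \<open>u (u - \<Delta>r)\<close>, but the budget forces at least \<open>u - \<Delta>r\<close> nodes of \<open>H\<close> to be
  unchanged, each of which contributes \<open>Mbar \<ge> u\<close>.\<close>

section \<open>The weight of a cut\<close>

definition grid_edges :: "node set \<Rightarrow> node set set" where
  "grid_edges G = {{v, w} | v w. v \<in> G \<and> w \<in> G \<and> grid_adj v w}"

definition splits :: "'a set \<Rightarrow> 'a set \<Rightarrow> bool" where
  "splits U e \<longleftrightarrow> e \<inter> U \<noteq> {} \<and> \<not> e \<subseteq> U"

lemma splits_pair: "splits U {v, w} \<longleftrightarrow> (v \<in> U) \<noteq> (w \<in> U)"
  unfolding splits_def by auto

lemma exists_crossing_step:
  assumes "p \<noteq> []" "(hd p \<in> U) \<noteq> (last p \<in> U)"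
  shows "\<exists>k. Suc k < length p \<and> (p ! k \<in> U) \<noteq> (p ! Suc k \<in> U)"
  using assms
proof (induction p)
  case (Cons a p)
  then have "p \<noteq> []" by auto
  show ?case
  proof (cases "(a \<in> U) = (hd p \<in> U)")
    case True
    then obtain k where "Suc k < length p" "(p ! k \<in> U) \<noteq> (p ! Suc k \<in> U)"
      using Cons \<open>p \<noteq> []\<close> by auto
    then show ?thesis by (intro exI[of _ "Suc k"]) auto
  next
    case False
    then show ?thesis using \<open>p \<noteq> []\<close> by (intro exI[of _ 0]) (auto simp: hd_conv_nth)
  qed
qed simp

lemma path_crosses_cut:
  assumes "path_in G v w p" "(v \<in> U) \<noteq> (w \<in> U)"
  shows "\<exists>e \<in> path_edges p. e \<in> grid_edges G \<and> splits U e"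
proof -
  have p: "p \<noteq> []" "hd p = v" "last p = w" "set p \<subseteq> G" "successively grid_adj p"
    using assms(1) unfolding path_in_def by auto
  obtain k where k: "Suc k < length p" "(p ! k \<in> U) \<noteq> (p ! Suc k \<in> U)"
    using exists_crossing_step[of p U] p assms(2) by auto
  have "grid_adj (p ! k) (p ! Suc k)"
    using p(5) k(1) by (simp add: successively_conv_nth)
  moreover have "p ! k \<in> G" "p ! Suc k \<in> G"
    using p(4) k(1) by (auto intro: nth_mem)
  ultimately have "{p ! k, p ! Suc k} \<in> grid_edges G"
    unfolding grid_edges_def by blast
  moreover have "{p ! k, p ! Suc k} \<in> path_edges p"
    unfolding path_edges_def using k(1) by blast
  ultimately show ?thesis using k(2) by (auto simp: splits_pair intro!: bexI)
qed

lemma finite_grid_edges: "finite G \<Longrightarrow> finite (grid_edges G)"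
  by (rule finite_subset[of _ "Pow G"]) (auto simp: grid_edges_def)

lemma finite_missing_edges: "finite G \<Longrightarrow> finite (missing_edges G)"
  by (rule finite_subset[of _ "Pow G"]) (auto simp: missing_edges_def)

text \<open>An ordered pair in \<open>U \<times> (G - U)\<close> can be recovered from its set: only its first component
  lies in \<open>U\<close>.\<close>

lemma card_split_pairs:
  assumes "U \<subseteq> G"
  shows "card ((\<lambda>(v, w). {v, w}) ` (U \<times> (G - U))) = card U * card (G - U)"
proof -
  have "inj_on (\<lambda>(v, w). {v, w}) (U \<times> (G - U))"
    by (auto simp: inj_on_def doubleton_eq_iff)
  then show ?thesis by (simp add: card_image card_cartesian_product)
qed

text \<open>Double counting: the initial weights of the cut count the split pairs that are edges, the
  increments count, for every split missing edge, the crossings of its path with the cut.\<close>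

lemma cut_weight_ge:
  assumes fin: "finite G" and U: "U \<subseteq> G" and P: "shortest_path_choice G P"
  shows "card U * card (G - U) \<le> (\<Sum>e | e \<in> grid_edges G \<and> splits U e. path_weight G P e)"
proof -
  define C where "C = {e. e \<in> grid_edges G \<and> splits U e}"
  define F where "F = {f \<in> missing_edges G. splits U f}"
  have fins: "finite C" "finite F" "finite (missing_edges G)"
    using finite_grid_edges[OF fin] finite_missing_edges[OF fin] unfolding C_def F_def by auto
  have "(\<lambda>(v, w). {v, w}) ` (U \<times> (G - U)) \<subseteq> C \<union> F"
  proof clarify
    fix v w assume vw: "v \<in> U" "w \<in> G" "w \<notin> U" "{v, w} \<notin> F"
    then have "v \<in> G" "v \<noteq> w" "splits U {v, w}"
      using U by (auto simp: splits_pair)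
    moreover from this vw have "{v, w} \<notin> missing_edges G"
      unfolding F_def by blast
    ultimately show "{v, w} \<in> C"
      using vw unfolding C_def missing_edges_def grid_edges_def by blast
  qed
  then have "card ((\<lambda>(v, w). {v, w}) ` (U \<times> (G - U))) \<le> card (C \<union> F)"
    using fins by (intro card_mono) auto
  also have "\<dots> \<le> card C + card F"
    by (rule card_Un_le)
  finally have pairs: "card U * card (G - U) \<le> card C + card F"
    by (simp add: card_split_pairs[OF U])
  have crossed: "1 \<le> card {e \<in> C. e \<in> path_edges (P f)}" if f: "f \<in> F" for f
  proof -
    have "f \<in> missing_edges G" "splits U f"
      using f unfolding F_def by auto
    then obtain v w where vw: "f = {v, w}" "path_in G v w (P f)"
      using P unfolding shortest_path_choice_def shortest_path_in_def by blast
    have "(v \<in> U) \<noteq> (w \<in> U)"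
      using \<open>splits U f\<close> unfolding vw(1) by (simp add: splits_pair)
    then have "{e \<in> C. e \<in> path_edges (P f)} \<noteq> {}"
      using path_crosses_cut[OF vw(2)] unfolding C_def by blast
    then show ?thesis
      using fins(1) by (simp add: Suc_le_eq card_gt_0_iff)
  qed
  have "card F \<le> (\<Sum>f\<in>F. card {e \<in> C. e \<in> path_edges (P f)})"
    using sum_mono[of F "\<lambda>_. 1::nat"] crossed by simp
  also have "\<dots> \<le> (\<Sum>f\<in>missing_edges G. card {e \<in> C. e \<in> path_edges (P f)})"
    using fins(3) by (intro sum_mono2) (auto simp: F_def)
  also have "\<dots> = (\<Sum>e\<in>C. card {f \<in> missing_edges G. e \<in> path_edges (P f)})"
    using fins by (intro sum_multicount_gen[symmetric]) auto
  finally have "card C + card F \<le> (\<Sum>e\<in>C. path_weight G P e)"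
    unfolding path_weight_def by (simp only: sum.distrib card_eq_sum)
  with pairs show ?thesis unfolding C_def by linarith
qed

lemma grid_edge_cases:
  assumes "e \<in> grid_edges G"
  shows "e \<in> (\<lambda>(i, j). {(i, j), (i + 1, j)}) ` {(i, j). (i, j) \<in> G \<and> (i + 1, j) \<in> G}
    \<or> e \<in> (\<lambda>(i, j). {(i, j), (i, j + 1)}) ` {(i, j). (i, j) \<in> G \<and> (i, j + 1) \<in> G}"
proof -
  obtain a b a' b' where e: "e = {(a, b), (a', b')}"
    and G: "(a, b) \<in> G" "(a', b') \<in> G" and adj: "grid_adj (a, b) (a', b')"
    using assms unfolding grid_edges_def by auto
  from adj consider "b = b'" "a' = a + 1" | "b = b'" "a = a' + 1"
    | "a = a'" "b' = b + 1" | "a = a'" "b = b' + 1"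
    unfolding grid_adj_def by auto
  then show ?thesis
  proof cases
    case 1
    then show ?thesis using e G by (intro disjI1 image_eqI[of _ _ "(a, b)"]) auto
  next
    case 2
    then show ?thesis using e G by (intro disjI1 image_eqI[of _ _ "(a', b')"]) auto
  next
    case 3
    then show ?thesis using e G by (intro disjI2 image_eqI[of _ _ "(a, b)"]) auto
  next
    case 4
    then show ?thesis using e G by (intro disjI2 image_eqI[of _ _ "(a', b')"]) auto
  qed
qed

lemma sum_grid_edges_le:
  fixes f :: "node set \<Rightarrow> real"
  assumes fin: "finite G" and nonneg: "\<And>e. f e \<ge> 0"
  shows "sum f (grid_edges G)
    \<le> (\<Sum>(i, j) | (i, j) \<in> G \<and> (i + 1, j) \<in> G. f {(i, j), (i + 1, j)})
      + (\<Sum>(i, j) | (i, j) \<in> G \<and> (i, j + 1) \<in> G. f {(i, j), (i, j + 1)})"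
proof -
  let ?V = "{(i, j). (i, j) \<in> G \<and> (i + 1, j) \<in> G}"
  let ?W = "{(i, j). (i, j) \<in> G \<and> (i, j + 1) \<in> G}"
  let ?v = "\<lambda>(i, j). {(i, j), (i + 1, j)} :: node set"
  let ?w = "\<lambda>(i, j). {(i, j), (i, j + 1)} :: node set"
  have fins: "finite ?V" "finite ?W"
    by (rule finite_subset[OF _ fin], auto)+
  have "sum f (grid_edges G) \<le> sum f (?v ` ?V \<union> ?w ` ?W)"
    using fins nonneg grid_edge_cases[of _ G] by (intro sum_mono2) blast+
  also have "\<dots> \<le> sum f (?v ` ?V) + sum f (?w ` ?W)"
    using fins nonneg by (simp add: sum_Un sum_nonneg)
  also have "\<dots> \<le> sum (f \<circ> ?v) ?V + sum (f \<circ> ?w) ?W"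
    using fins nonneg by (intro add_mono sum_image_le) auto
  finally show ?thesis by (simp add: comp_def case_prod_unfold)
qed

text \<open>The combinatorial half of the inequality: the bounds on \<open>\<beta>\<close> and \<open>\<gamma>\<close> say that they dominate
  the variation of the indicator function of \<open>U\<close> along the edges of \<open>G\<close>, so the weighted sum is
  at least the weight of the cut around \<open>U\<close>.\<close>

lemma weighted_variation_ge:
  fixes \<beta> \<gamma> :: "nat \<Rightarrow> nat \<Rightarrow> real"
  assumes fin: "finite G" and U: "U \<subseteq> G" and P: "shortest_path_choice G P"
    and \<beta>: "\<And>i j. (i, j) \<in> G \<Longrightarrow> (i + 1, j) \<in> G \<Longrightarrow> of_bool (((i, j) \<in> U) \<noteq> ((i + 1, j) \<in> U)) \<le> \<beta> i j"
    and \<gamma>: "\<And>i j. (i, j) \<in> G \<Longrightarrow> (i, j + 1) \<in> G \<Longrightarrow> of_bool (((i, j) \<in> U) \<noteq> ((i, j + 1) \<in> U)) \<le> \<gamma> i j"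
  shows "real (card U) * (real (card G) - real (card U))
    \<le> (\<Sum>(i, j) | (i, j) \<in> G \<and> (i + 1, j) \<in> G. real (w_beta G P i j) * \<beta> i j)
      + (\<Sum>(i, j) | (i, j) \<in> G \<and> (i, j + 1) \<in> G. real (w_gamma G P i j) * \<gamma> i j)"
proof -
  define f where "f e = real (path_weight G P e) * of_bool (splits U e)" for e
  have "card (G - U) = card G - card U" "card U \<le> card G"
    using fin U by (auto simp: card_Diff_subset finite_subset card_mono)
  then have "real (card U) * (real (card G) - real (card U)) = real (card U * card (G - U))"
    by (simp add: of_nat_diff)
  also have "\<dots> \<le> real (\<Sum>e | e \<in> grid_edges G \<and> splits U e. path_weight G P e)"
    using cut_weight_ge[OF fin U P] by (rule of_nat_mono)
  also have "\<dots> = sum f (grid_edges G)"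
    unfolding f_def of_nat_sum using finite_grid_edges[OF fin]
    by (intro sum.mono_neutral_cong_left) auto
  also have "\<dots> \<le> (\<Sum>(i, j) | (i, j) \<in> G \<and> (i + 1, j) \<in> G. f {(i, j), (i + 1, j)})
      + (\<Sum>(i, j) | (i, j) \<in> G \<and> (i, j + 1) \<in> G. f {(i, j), (i, j + 1)})"
    using fin by (rule sum_grid_edges_le) (simp add: f_def)
  also have "\<dots> \<le> (\<Sum>(i, j) | (i, j) \<in> G \<and> (i + 1, j) \<in> G. real (w_beta G P i j) * \<beta> i j)
      + (\<Sum>(i, j) | (i, j) \<in> G \<and> (i, j + 1) \<in> G. real (w_gamma G P i j) * \<gamma> i j)"
    unfolding f_def w_beta_def w_gamma_def splits_pair
    using \<beta> \<gamma> by (intro add_mono sum_mono) (auto simp only: split_beta fst_conv snd_conv mult.assoc mem_Collect_eq prod.case intro!: mult_left_mono)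
  finally show ?thesis .
qed

section \<open>The threshold for the multiplier\<close>

lemma quotient_eq:
  fixes g u r :: real
  assumes "u > r"
  shows "((g - u) * u - (g - r) * r) / (u - r) = g - u - r"
  using assms by (simp add: field_simps)

text \<open>By the cancellation above, the minimum in \<open>M0\<close> is attained at any subset with
  \<open>min (card G) \<Delta>\<close> nodes. Such a set is admissible: \<open>\<Delta>out > 0\<close> gives \<open>\<Delta> > \<Delta>r\<close>, and \<open>rho > 0\<close> gives
  \<open>card G > \<Delta>r\<close>.\<close>

lemma M0_eq_min:
  assumes fin: "finite G" and \<Delta>out: "\<Delta>out > 0" and rho: "rho G \<Delta> \<Delta>out > 0"
  shows "M0 G \<Delta> \<Delta>out = min (real (card G)) (real \<Delta>)"
proof -
  define r where "r = real \<Delta> - real \<Delta>out"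
  define g where "g = real (card G)"
  define m where "m = min (card G) \<Delta>"
  let ?A = "{((g - real (card U)) * real (card U) - (g - r) * r) / (real (card U) - r) | U.
              U \<subseteq> G \<and> card U \<le> \<Delta> \<and> real (card U) > r}"
  have m: "real m > r"
    using \<Delta>out rho unfolding m_def r_def rho_def by (auto simp: min_def)
  obtain U where U: "U \<subseteq> G" "card U = m"
    using obtain_subset_with_card_n[of m G] unfolding m_def by auto
  have "Min ?A = g - real m - r"
  proof (rule Min_eqI)
    show "finite ?A" using fin by auto
  next
    fix y assume "y \<in> ?A"
    then obtain V where V: "V \<subseteq> G" "card V \<le> \<Delta>" "real (card V) > r"
      and y: "y = ((g - real (card V)) * real (card V) - (g - r) * r) / (real (card V) - r)"
      by blast
    have "card V \<le> m" using V(1,2) fin unfolding m_def by (simp add: card_mono)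
    then show "g - real m - r \<le> y" unfolding y quotient_eq[OF V(3)] by simp
  next
    have "card U \<le> \<Delta>" "real (card U) > r" using U m unfolding m_def by auto
    moreover have "g - real m - r
        = ((g - real (card U)) * real (card U) - (g - r) * r) / (real (card U) - r)"
      unfolding U(2) quotient_eq[OF m] ..
    ultimately show "g - real m - r \<in> ?A" using U(1) by blast
  qed
  then show ?thesis
    unfolding M0_def Let_def rho_def r_def g_def m_def by (simp add: of_nat_min)
qed

text \<open>Here \<open>u\<close> and \<open>h\<close> count the changed nodes of \<open>G\<close> and \<open>H\<close>, \<open>b\<close> is the size of \<open>H\<close>, and the budget
  \<open>r + b\<close> turns every changed node of \<open>G\<close> beyond \<open>r\<close> into an unchanged node of \<open>H\<close>.\<close>

lemma cut_inequality_arith: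
  fixes g u h r b K :: real
  assumes "0 \<le> u" "0 \<le> K" "h \<le> b" "u + h \<le> r + b" and large: "r < u \<Longrightarrow> u \<le> K"
  shows "(g - r) * u - K * b \<le> u * (g - u) - K * h"
proof (cases "r < u")
  case True
  have "u * (u - r) \<le> K * (b - h)"
    using assms True by (intro mult_mono) auto
  then show ?thesis by (simp add: algebra_simps)
next
  case False
  have "0 \<le> u * (r - u)" "0 \<le> K * (b - h)"
    using assms False by auto
  then show ?thesis by (simp add: algebra_simps)
qed

section \<open>The cut inequality\<close>

theorem theorem8:
  fixes N M \<Delta> \<Delta>out :: nat
    and x :: "nat \<Rightarrow> nat \<Rightarrow> int"
    and \<Xi> :: "int set"
    and G H :: "node set"
    and P :: "node set \<Rightarrow> node list"
  defines "\<Xi> \<equiv> {0, 1}"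
  assumes x_in: "\<And>i j. i \<in> {1..N} \<Longrightarrow> j \<in> {1..M} \<Longrightarrow> x i j \<in> \<Xi>"
    and \<Delta>out: "\<Delta>out \<le> \<Delta>"
    and subgraphs: "G \<subseteq> grid_nodes N M" "H \<subseteq> grid_nodes N M" "G \<inter> H = {}"
    and card_H: "card H = \<Delta>out"
    and conn: "connected_subgraph G"
    and const: "\<exists>a. \<forall>(i, j)\<in>G. x i j = a"
    and rho_pos: "rho G \<Delta> \<Delta>out > 0"
    and paths: "shortest_path_choice G P"
  shows "(\<Delta>out > 0 \<longrightarrow>
           M0 G \<Delta> \<Delta>out =
             (let \<Delta>r = real \<Delta> - real \<Delta>out; g = real (card G); m = min g (real \<Delta>) in
              rho G \<Delta> \<Delta>out - ((g - m) * m - (g - \<Delta>r) * \<Delta>r) / (m - \<Delta>r))) \<and>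
         (\<forall>d \<delta> \<beta> \<gamma> Mbar.
           ip_feasible \<Xi> N M x \<Delta> d \<delta> \<beta> \<gamma> \<longrightarrow>
           (\<forall>(i, j)\<in>G \<union> H. \<delta> i j = \<bar>of_int (d i j)\<bar>) \<longrightarrow>
           (\<Delta>out > 0 \<longrightarrow> Mbar \<ge> M0 G \<Delta> \<Delta>out) \<longrightarrow>
           rho G \<Delta> \<Delta>out * (\<Sum>(i, j)\<in>G. \<delta> i j) - Mbar * real \<Delta>out
             \<le> (\<Sum>(i, j) | (i, j) \<in> G \<and> (i + 1, j) \<in> G. real (w_beta G P i j) * \<beta> i j)
               + (\<Sum>(i, j) | (i, j) \<in> G \<and> (i, j + 1) \<in> G. real (w_gamma G P i j) * \<gamma> i j)
               - Mbar * (\<Sum>(i, j)\<in>H. \<delta> i j))"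
proof -
  have fin: "finite G" "finite H"
    using subgraphs(1,2) finite_subset unfolding grid_nodes_def by blast+
  have M0: "M0 G \<Delta> \<Delta>out = min (real (card G)) (real \<Delta>)" if "\<Delta>out > 0"
    using M0_eq_min[OF fin(1) that rho_pos] .
  have "M0 G \<Delta> \<Delta>out =
      (let \<Delta>r = real \<Delta> - real \<Delta>out; g = real (card G); m = min g (real \<Delta>) in
        rho G \<Delta> \<Delta>out - ((g - m) * m - (g - \<Delta>r) * \<Delta>r) / (m - \<Delta>r))" if "\<Delta>out > 0"
  proof -
    have "min (real (card G)) (real \<Delta>) > real \<Delta> - real \<Delta>out"
      using that rho_pos unfolding rho_def by auto
    then show ?thesis
      unfolding M0[OF that] Let_def by (subst quotient_eq) (auto simp: rho_def)
  qed
  moreover have "rho G \<Delta> \<Delta>out * (\<Sum>(i, j)\<in>G. \<delta> i j) - K * real \<Delta>out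
      \<le> (\<Sum>(i, j) | (i, j) \<in> G \<and> (i + 1, j) \<in> G. real (w_beta G P i j) * \<beta> i j)
        + (\<Sum>(i, j) | (i, j) \<in> G \<and> (i, j + 1) \<in> G. real (w_gamma G P i j) * \<gamma> i j)
        - K * (\<Sum>(i, j)\<in>H. \<delta> i j)"
    if feas: "ip_feasible \<Xi> N M x \<Delta> d \<delta> \<beta> \<gamma>"
      and tight: "\<forall>(i, j)\<in>G \<union> H. \<delta> i j = \<bar>of_int (d i j)\<bar>"
      and K: "\<Delta>out > 0 \<longrightarrow> K \<ge> M0 G \<Delta> \<Delta>out"
    for d \<delta> \<beta> \<gamma> K
  proof -
    have bounds: "0 \<le> x i j + d i j" "x i j + d i j \<le> 1" "x i j = 0 \<or> x i j = 1"
      if "(i, j) \<in> grid_nodes N M" for i j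
      using feas x_in[of i j] that unfolding ip_feasible_def \<Xi>_def grid_nodes_def by auto
    have \<delta>_nonneg: "0 \<le> \<delta> i j" if "(i, j) \<in> grid_nodes N M" for i j
    proof -
      have "- \<delta> i j \<le> of_int (d i j)" "of_int (d i j) \<le> \<delta> i j"
        using feas that unfolding ip_feasible_def grid_nodes_def by auto
      then show ?thesis by linarith
    qed
    have \<delta>_binary: "\<delta> i j = of_bool (d i j \<noteq> 0)" if "(i, j) \<in> G \<union> H" for i j
    proof -
      have "(i, j) \<in> grid_nodes N M" using that subgraphs by auto
      then have "d i j = 0 \<or> \<bar>d i j\<bar> = 1" using bounds[of i j] by auto
      moreover have "\<delta> i j = of_int \<bar>d i j\<bar>" using tight that by auto
      ultimately show ?thesis by auto
    qed
    define U where "U = {(i, j). (i, j) \<in> G \<and> d i j \<noteq> 0}"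
    define h where "h = (\<Sum>(i, j)\<in>H. \<delta> i j)"
    have UG: "U \<subseteq> G" unfolding U_def by auto
    have sum_G: "(\<Sum>(i, j)\<in>G. \<delta> i j) = real (card U)"
    proof -
      have "(\<Sum>(i, j)\<in>G. \<delta> i j) = (\<Sum>v\<in>G. of_bool (v \<in> U))"
        using \<delta>_binary by (intro sum.cong) (auto simp: U_def)
      also have "\<dots> = real (card U)"
        using fin(1) UG by (simp add: Int_absorb1)
      finally show ?thesis .
    qed
    have h_le: "h \<le> real \<Delta>out"
    proof -
      have "h \<le> (\<Sum>v\<in>H. 1)"
        unfolding h_def using \<delta>_binary by (intro sum_mono) auto
      then show ?thesis using card_H by simp
    qed
    have budget: "real (card U) + h \<le> real \<Delta>"
    proof -
      have "real (card U) + h = (\<Sum>(i, j)\<in>G \<union> H. \<delta> i j)"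
        unfolding h_def sum_G[symmetric] using fin subgraphs(3) by (simp add: sum.union_disjoint)
      also have "\<dots> \<le> (\<Sum>(i, j)\<in>grid_nodes N M. \<delta> i j)"
        using subgraphs(1,2) \<delta>_nonneg by (intro sum_mono2) (auto simp: grid_nodes_def)
      also have "\<dots> \<le> real \<Delta>"
        using feas unfolding ip_feasible_def grid_nodes_def sum.cartesian_product by simp
      finally show ?thesis .
    qed
    \<comment> \<open>As \<open>x\<close> is constant on \<open>G\<close>, the new values of two nodes differ iff one of them changed.\<close>
    obtain a where a: "\<And>i j. (i, j) \<in> G \<Longrightarrow> x i j = a"
      using const by auto
    have change: "d i j = (if (i, j) \<in> U then 1 - 2 * a else 0) \<and> (a = 0 \<or> a = 1)"
      if "(i, j) \<in> G" for i j
    proof -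
      have "0 \<le> a + d i j" "a + d i j \<le> 1" "a = 0 \<or> a = 1"
        using bounds[of i j] a[OF that] subgraphs(1) that by auto
      then show ?thesis using that by (auto simp: U_def)
    qed
    have "real (card U) * (real (card G) - real (card U))
      \<le> (\<Sum>(i, j) | (i, j) \<in> G \<and> (i + 1, j) \<in> G. real (w_beta G P i j) * \<beta> i j)
        + (\<Sum>(i, j) | (i, j) \<in> G \<and> (i, j + 1) \<in> G. real (w_gamma G P i j) * \<gamma> i j)"
    proof (rule weighted_variation_ge[OF fin(1) UG paths])
      fix i j assume ij: "(i, j) \<in> G" "(i + 1, j) \<in> G"
      then have "i \<in> {1..<N}" "j \<in> {1..M}"
        using subgraphs(1) unfolding grid_nodes_def by auto
      then have "- \<beta> i j \<le> of_int (x (i + 1) j + d (i + 1) j - x i j - d i j)"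
        "of_int (x (i + 1) j + d (i + 1) j - x i j - d i j) \<le> \<beta> i j"
        using feas unfolding ip_feasible_def by blast+
      then show "of_bool (((i, j) \<in> U) \<noteq> ((i + 1, j) \<in> U)) \<le> \<beta> i j"
        using change[OF ij(1)] change[OF ij(2)] a[OF ij(1)] a[OF ij(2)]
        by (auto split: if_splits)
    next
      fix i j assume ij: "(i, j) \<in> G" "(i, j + 1) \<in> G"
      then have "i \<in> {1..N}" "j \<in> {1..<M}"
        using subgraphs(1) unfolding grid_nodes_def by auto
      then have "- \<gamma> i j \<le> of_int (x i (j + 1) + d i (j + 1) - x i j - d i j)"
        "of_int (x i (j + 1) + d i (j + 1) - x i j - d i j) \<le> \<gamma> i j"
        using feas unfolding ip_feasible_def by blast+
      then show "of_bool (((i, j) \<in> U) \<noteq> ((i, j + 1) \<in> U)) \<le> \<gamma> i j"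
        using change[OF ij(1)] change[OF ij(2)] a[OF ij(1)] a[OF ij(2)]
        by (auto split: if_splits)
    qed
    moreover have "rho G \<Delta> \<Delta>out * real (card U) - K * real \<Delta>out
      \<le> real (card U) * (real (card G) - real (card U)) - K * h"
    proof (cases "\<Delta>out = 0")
      case True
      \<comment> \<open>Now \<open>K\<close> may be negative, but its coefficient vanishes, so it can be replaced by \<open>0\<close>.\<close>
      then have "h = 0" using card_H fin(2) unfolding h_def by simp
      then show ?thesis
        using True budget
          cut_inequality_arith[of "real (card U)" 0 0 0 "real \<Delta>" "real (card G)"]
        by (simp add: rho_def)
    next
      case False
      have "card U \<le> card G" using fin(1) UG by (rule card_mono)
      moreover have "0 \<le> h"
        unfolding h_def using subgraphs(2) \<delta>_nonneg by (intro sum_nonneg) auto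
      ultimately have "real (card U) \<le> K"
        using K M0 False budget by auto
      then show ?thesis
        using budget h_le
          cut_inequality_arith[of "real (card U)" K h "real \<Delta>out" "real \<Delta> - real \<Delta>out" "real (card G)"]
        by (simp add: rho_def algebra_simps)
    qed
    ultimately show ?thesis unfolding sum_G h_def by linarith
  qed
  ultimately show ?thesis by blast
qed

end
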